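(* Suppose $\mathrm{MA}_{\aleph_1}(K)$ holds. Then for every function $p:[\omega_1]^2\to\omega$ the following are equivalent: (1) $\omega_1\to_p[\omega_1]^2_{\omega,\text{finite}}$, i.e., for every coloring $c:[\omega_1]^2\to\omega$ there is an uncountable $X\subseteq\omega_1$ such that for every $j<\omega$ the set $\{c(\alpha,\beta)\mid(\alpha,\beta)\in[X]^2\ \&\ p(\alpha,\beta)=j\}$ is finite; (2) there exists an uncountable $X\subseteq\omega_1$ such that $p\restriction[X]^2$ witnesses $\mathrm{U}(\omega_1,\omega_1,\omega,\omega)$.
   Context: For a set of ordinals $A$, $[A]^2$ denotes the set of pairs $(\alpha,\beta)$ with $\alpha,\beta\in A$, $\alpha<\beta$. For sets of ordinals $a,b$, write $a<b$ if every element of $a$ is below every element of $b$; for a family $\mathcal B$ of sets of ordinals, $[\mathcal B]^2=\{(a,b)\in\mathcal B\times\mathcal B\mid a<b\}$. For uncountable $X\subseteq\omega_1$, $p\restriction[X]^2$ witnesses $\mathrm{U}(\omega_1,\omega_1,\omega,\omega)$ means: for every finite $\sigma<\omega$, every uncountable family $\mathcal A$ of pairwise disjoint subsets of $X$ each of size $\sigma$, and every $\delta<\omega$, there is an uncountable $\mathcal B\subseteq\mathcal A$ such that $\min(p[a\times b])>\delta$ for all $(a,b)\in[\mathcal B]^2$. $\mathrm{MA}_{\aleph_1}(K)$: for every poset with Property K (every uncountable set of conditions contains an uncountable set of pairwise compatible conditions) and every $\aleph_1$ many dense subsets, there is a filter meeting all of them. *)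

theory Defs
  imports "HOL-Library.Countable_Set_Type"
begin

unbundle cardinal_syntax

text \<open>The ordinal \<open>\<omega>\<^sub>1\<close> as a type: the carrier of the successor cardinal of
  \<open>\<aleph>\<^sub>0\<close>, ordered by the (well-)order that this cardinal is in the library.\<close>

typedef omega1 = "Field (cardSuc natLeq)"
proof -
  have "Field (cardSuc natLeq) \<noteq> {}"
    using cardSuc_finite[OF natLeq_Card_order] by (metis Field_natLeq finite.emptyI infinite_UNIV_nat)
  then show ?thesis by blast
qed

lemma Well_order_cardSuc_natLeq: "Well_order (cardSuc natLeq)"
  using cardSuc_Card_order[OF natLeq_Card_order] card_order_on_well_order_on by blast

instantiation omega1 :: linorder
begin

definition less_eq_omega1 :: "omega1 \<Rightarrow> omega1 \<Rightarrow> bool"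
  where "\<alpha> \<le> \<beta> \<longleftrightarrow> (Rep_omega1 \<alpha>, Rep_omega1 \<beta>) \<in> cardSuc natLeq"

definition less_omega1 :: "omega1 \<Rightarrow> omega1 \<Rightarrow> bool"
  where "\<alpha> < \<beta> \<longleftrightarrow> \<alpha> \<le> \<beta> \<and> \<alpha> \<noteq> (\<beta> :: omega1)"

instance
proof -
  have r: "refl_on (Field (cardSuc natLeq)) (cardSuc natLeq)" and t: "trans (cardSuc natLeq)"
    and a: "antisym (cardSuc natLeq)" and l: "total_on (Field (cardSuc natLeq)) (cardSuc natLeq)"
    using Well_order_cardSuc_natLeq unfolding order_on_defs by auto
  have as: "\<alpha> = \<beta>" if "\<alpha> \<le> \<beta>" "\<beta> \<le> \<alpha>" for \<alpha> \<beta> :: omega1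
    using that a by (simp add: less_eq_omega1_def) (metis antisymD Rep_omega1_inject)
  show "OFCLASS(omega1, linorder_class)"
  proof
    fix \<alpha> \<beta> \<gamma> :: omega1
    show "\<alpha> < \<beta> \<longleftrightarrow> \<alpha> \<le> \<beta> \<and> \<not> \<beta> \<le> \<alpha>"
      using as less_omega1_def r Rep_omega1 by (auto simp: less_eq_omega1_def refl_on_def)
    show "\<alpha> \<le> \<alpha>"
      using r Rep_omega1 by (auto simp: less_eq_omega1_def refl_on_def)
    show "\<alpha> \<le> \<beta> \<Longrightarrow> \<beta> \<le> \<gamma> \<Longrightarrow> \<alpha> \<le> \<gamma>"
      using t by (auto simp: less_eq_omega1_def dest: transD)
    show "\<alpha> \<le> \<beta> \<Longrightarrow> \<beta> \<le> \<alpha> \<Longrightarrow> \<alpha> = \<beta>" by (rule as)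
    show "\<alpha> \<le> \<beta> \<or> \<beta> \<le> \<alpha>"
      using l r Rep_omega1 unfolding less_eq_omega1_def refl_on_def total_on_def by metis
  qed
qed

end

lemma less_omega1_iff:
  "\<alpha> < \<beta> \<longleftrightarrow> (Rep_omega1 \<alpha>, Rep_omega1 \<beta>) \<in> cardSuc natLeq - Id"
  by (auto simp: less_omega1_def less_eq_omega1_def Rep_omega1_inject)

instance omega1 :: wellorder
proof
  fix P :: "omega1 \<Rightarrow> bool" and \<alpha>
  assume step: "\<And>\<alpha>. (\<And>\<beta>. \<beta> < \<alpha> \<Longrightarrow> P \<beta>) \<Longrightarrow> P \<alpha>"
  have "wf (cardSuc natLeq - Id)"
    using Well_order_cardSuc_natLeq by (simp add: well_order_on_def)
  then have "wf (inv_image (cardSuc natLeq - Id) Rep_omega1)" by (rule wf_inv_image)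
  then show "P \<alpha>"
    by (induction \<alpha> rule: wf_induct_rule) (auto intro: step simp: less_omega1_iff in_inv_image)
qed

lemma uncountable_omega1: "uncountable (UNIV :: omega1 set)"
proof
  assume "countable (UNIV :: omega1 set)"
  then have "countable (Field (cardSuc natLeq))"
    using countable_image[of UNIV Rep_omega1]
    by (simp add: type_definition.Rep_range[OF type_definition_omega1])
  then have "|Field (cardSuc natLeq)| \<le>o natLeq" by (simp add: countable_card_le_natLeq)
  moreover have "|Field (cardSuc natLeq)| =o cardSuc natLeq"
    using cardSuc_Card_order[OF natLeq_Card_order] by (rule card_of_Field_ordIso)
  ultimately have "cardSuc natLeq \<le>o natLeq"
    using ordIso_ordLeq_trans ordIso_symmetric by blast
  then show False
    using cardSuc_greater[OF natLeq_Card_order] not_ordLess_ordLeq by blast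
qed

lemma countable_lessThan_omega1: "countable {..< \<alpha> :: omega1}"
proof -
  have "|underS (cardSuc natLeq) (Rep_omega1 \<alpha>)| <o cardSuc natLeq"
    by (rule card_of_underS[OF cardSuc_Card_order[OF natLeq_Card_order] Rep_omega1])
  then have "|underS (cardSuc natLeq) (Rep_omega1 \<alpha>)| \<le>o natLeq"
    using cardSuc_ordLeq_ordLess[OF natLeq_Card_order card_of_Card_order] by blast
  then have "countable (underS (cardSuc natLeq) (Rep_omega1 \<alpha>))"
    by (simp add: countable_card_le_natLeq)
  moreover have "Rep_omega1 ` {..<\<alpha>} \<subseteq> underS (cardSuc natLeq) (Rep_omega1 \<alpha>)"
    by (auto simp: less_omega1_iff underS_def)
  ultimately have "countable (Rep_omega1 ` {..<\<alpha>})" by (rule countable_subset[rotated])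
  then show ?thesis
    using Rep_omega1_inject by (metis countable_image_inj_on inj_onI)
qed

definition pairs2 :: "'a::ord set \<Rightarrow> ('a \<times> 'a) set"
  where "pairs2 A = {(\<alpha>, \<beta>). \<alpha> \<in> A \<and> \<beta> \<in> A \<and> \<alpha> < \<beta>}"

definition set_below :: "'a::ord set \<Rightarrow> 'a set \<Rightarrow> bool"
  where "set_below a b \<longleftrightarrow> (\<forall>\<alpha>\<in>a. \<forall>\<beta>\<in>b. \<alpha> < \<beta>)"

definition set_pairs2 :: "'a::ord set set \<Rightarrow> ('a set \<times> 'a set) set"
  where "set_pairs2 B = {(a, b). a \<in> B \<and> b \<in> B \<and> set_below a b}"

text \<open>A function on \<open>[\<omega>\<^sub>1]\<^sup>2\<close> is represented by a function on all pairs; the two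
  definitions below only inspect its values at pairs \<open>(\<alpha>, \<beta>)\<close> with \<open>\<alpha> < \<beta>\<close>. In
  \<open>witnesses_U\<close> an uncountable disjoint family forces \<open>\<sigma> > 0\<close>, so that the minimum is
  that of a nonempty finite set.\<close>

definition witnesses_U :: "(omega1 \<times> omega1 \<Rightarrow> nat) \<Rightarrow> omega1 set \<Rightarrow> bool"
  where "witnesses_U p X \<longleftrightarrow>
    (\<forall>\<sigma>::nat. \<forall>A::omega1 set set. \<forall>\<delta>::nat.
      uncountable A \<and> pairwise disjnt A \<and> (\<forall>a\<in>A. a \<subseteq> X \<and> finite a \<and> card a = \<sigma>) \<longrightarrow>
      (\<exists>B\<subseteq>A. uncountable B \<and> (\<forall>(a, b)\<in>set_pairs2 B. Min (p ` (a \<times> b)) > \<delta>)))"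

definition arrow_finite :: "(omega1 \<times> omega1 \<Rightarrow> nat) \<Rightarrow> bool"
  where "arrow_finite p \<longleftrightarrow>
    (\<forall>c :: omega1 \<times> omega1 \<Rightarrow> nat. \<exists>X. uncountable X \<and>
      (\<forall>j. finite {c (\<alpha>, \<beta>) | \<alpha> \<beta>. (\<alpha>, \<beta>) \<in> pairs2 X \<and> p (\<alpha>, \<beta>) = j}))"

text \<open>Forcing notions: a nonempty carrier \<open>P\<close> and a partial order \<open>r\<close> on it, where
  \<open>(x, y) \<in> r\<close> means \<open>x \<le> y\<close>, i.e. \<open>x\<close> is the stronger condition.\<close>

definition compatible_in :: "'p set \<Rightarrow> 'p rel \<Rightarrow> 'p \<Rightarrow> 'p \<Rightarrow> bool"
  where "compatible_in P r x y \<longleftrightarrow> (\<exists>z\<in>P. (z, x) \<in> r \<and> (z, y) \<in> r)"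

definition property_K :: "'p set \<Rightarrow> 'p rel \<Rightarrow> bool"
  where "property_K P r \<longleftrightarrow>
    (\<forall>A\<subseteq>P. uncountable A \<longrightarrow> (\<exists>B\<subseteq>A. uncountable B \<and> pairwise (compatible_in P r) B))"

definition dense_in_poset :: "'p set \<Rightarrow> 'p rel \<Rightarrow> 'p set \<Rightarrow> bool"
  where "dense_in_poset P r D \<longleftrightarrow> D \<subseteq> P \<and> (\<forall>x\<in>P. \<exists>d\<in>D. (d, x) \<in> r)"

definition filter_in_poset :: "'p set \<Rightarrow> 'p rel \<Rightarrow> 'p set \<Rightarrow> bool"
  where "filter_in_poset P r G \<longleftrightarrow> G \<subseteq> P \<and> G \<noteq> {} \<and>
    (\<forall>x\<in>G. \<forall>y\<in>P. (x, y) \<in> r \<longrightarrow> y \<in> G) \<and>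
    (\<forall>x\<in>G. \<forall>y\<in>G. \<exists>z\<in>G. (z, x) \<in> r \<and> (z, y) \<in> r)"

text \<open>\<open>MA\<^bsub>\<aleph>\<^sub>1\<^esub>(K)\<close> for the posets whose conditions are drawn from the type \<open>'p\<close>.
  HOL cannot quantify over types within a formula, so the universe of conditions is a parameter.
  For countable \<open>'p\<close> this only covers countable posets and is weaker than the axiom. For
  every uncountable \<open>'p\<close> it amounts to the full axiom, because a poset with Property K and
  \<open>\<aleph>\<^sub>1\<close> many dense sets has a suborder of size at most \<open>\<aleph>\<^sub>1\<close> with the same
  compatibility relation, hence with Property K, in which the traces of the dense sets are dense.\<close>

definition MA_aleph1_K :: "'p itself \<Rightarrow> bool"
  where "MA_aleph1_K _ \<longleftrightarrow>
    (\<forall>(P :: 'p set) (r :: 'p rel) (D :: omega1 \<Rightarrow> 'p set).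
      P \<noteq> {} \<and> partial_order_on P r \<and> property_K P r \<and> (\<forall>\<xi>. dense_in_poset P r (D \<xi>)) \<longrightarrow>
      (\<exists>G. filter_in_poset P r G \<and> (\<forall>\<xi>. G \<inter> D \<xi> \<noteq> {})))"

end

theory Submission
  imports Defs
begin

text \<open>From (1) to (2) no forcing axiom is needed: applying (1) to a colouring \<open>c\<close> with all
  \<open>c(\<cdot>, \<beta>)\<close> injective gives an uncountable \<open>X\<close> such that each \<open>p(\<cdot>, \<beta>)\<close> is finite-to-one
  on \<open>X \<inter> \<beta>\<close>. For a disjoint family \<open>\<A>\<close> of finite subsets of \<open>X\<close>, join \<open>a < b\<close> whenever
  \<open>min p[a \<times> b] \<le> \<delta>\<close>; every \<open>b\<close> has finitely many lower neighbours, so the greedy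
  colouring uses countably many colours and some colour class is uncountable.

  From (2) to (1), force with pairs \<open>(a, f)\<close>, where \<open>a \<subseteq> X\<close> is finite and the finite sequence
  \<open>f\<close> promises that \<open>c \<le> f(j)\<close> on the pairs from \<open>a\<close> with \<open>p = j < length f\<close>. Among uncountably
  many conditions one may fix \<open>f\<close> and let the sets \<open>a\<close> form a \<open>\<Delta>\<close>-system; applying U with
  \<open>\<delta> = length f\<close> to the tails makes the mixed pairs irrelevant to \<open>f\<close>, which gives
  Property K. By the countable chain condition some condition forces the generic set to be
  uncountable.\<close>

section \<open>Uncountable families: cliques, Delta-systems, and sets of countable ordinals\<close>

text \<open>Zorn's lemma gives a maximal clique, and by \<open>ext\<close> a countable clique is
  never maximal. This takes the place of a recursion of length \<omega>1 in the thinning arguments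
  below.\<close>

lemma uncountable_clique:
  assumes sym: "\<And>x y. R x y \<Longrightarrow> R y x"
    and ext: "\<And>M. M \<subseteq> F \<Longrightarrow> countable M \<Longrightarrow> \<exists>x\<in>F - M. \<forall>m\<in>M. R m x"
  shows "\<exists>G\<subseteq>F. uncountable G \<and> pairwise R G"
proof -
  define \<C> where "\<C> = {G. G \<subseteq> F \<and> pairwise R G}"
  have chain: "\<Union>C \<in> \<C>" if C: "C \<noteq> {}" "subset.chain \<C> C" for C
  proof -
    have CC: "C \<subseteq> \<C>" and lin: "\<And>A B. A \<in> C \<Longrightarrow> B \<in> C \<Longrightarrow> A \<subseteq> B \<or> B \<subseteq> A"
      using C unfolding subset_chain_def by blast+
    have "R x y" if xy: "x \<in> \<Union>C" "y \<in> \<Union>C" "x \<noteq> y" for x y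
    proof -
      obtain A B where AB: "A \<in> C" "B \<in> C" "x \<in> A" "y \<in> B" using xy by blast
      then obtain D where "D \<in> C" "x \<in> D" "y \<in> D" using lin[OF AB(1,2)] by blast
      then show ?thesis using CC xy(3) unfolding \<C>_def pairwise_def by blast
    qed
    then show ?thesis using CC unfolding \<C>_def pairwise_def by blast
  qed
  have "{} \<in> \<C>" by (simp add: \<C>_def)
  then obtain M where M: "M \<in> \<C>" and max: "\<And>Z. Z \<in> \<C> \<Longrightarrow> M \<subseteq> Z \<Longrightarrow> Z = M"
    using subset_Zorn_nonempty[of \<C>, OF _ chain] by blast
  have MF: "M \<subseteq> F" "pairwise R M" using M by (auto simp: \<C>_def)
  have "uncountable M"
  proof
    assume "countable M"
    then obtain x where x: "x \<in> F - M" "\<forall>m\<in>M. R m x" using ext[OF MF(1)] by blast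
    have "insert x M \<in> \<C>" using x MF sym unfolding \<C>_def by (auto simp: pairwise_insert)
    then show False using max[of "insert x M"] x by blast
  qed
  then show ?thesis using MF by blast
qed

lemma uncountable_fibre:
  fixes f :: "'a \<Rightarrow> 'b"
  assumes "uncountable A" and "countable (f ` A)"
  shows "\<exists>y. uncountable {x\<in>A. f x = y}"
proof (rule ccontr)
  assume "\<not> ?thesis"
  then have "countable (\<Union>y\<in>f ` A. {x\<in>A. f x = y})" using assms(2) by blast
  moreover have "A = (\<Union>y\<in>f ` A. {x\<in>A. f x = y})" by blast
  ultimately show False using assms(1) by simp
qed

text \<open>Induction on the common size. If some point lies in uncountably many members, remove it
  from them, apply the induction hypothesis, and put it back, now as part of the root. Otherwise a
  countable subfamily meets only countably many members, so cliques for disjointness can be extended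
  and the root is empty.\<close>

lemma Delta_system_card:
  assumes "uncountable F" and "\<forall>a\<in>F. finite a \<and> card a = n"
  shows "\<exists>G\<subseteq>F. \<exists>r. uncountable G \<and> (\<forall>a\<in>G. r \<subseteq> a) \<and> pairwise (\<lambda>a b. a \<inter> b = r) G"
  using assms
proof (induction n arbitrary: F)
  case 0
  then have "F \<subseteq> {{}}" by auto
  then have "countable F" by (rule countable_subset) simp
  then show ?case using 0(1) by simp
next
  case (Suc n)
  show ?case
  proof (cases "\<exists>x. uncountable {a\<in>F. x \<in> a}")
    case True
    then obtain x where x: "uncountable {a\<in>F. x \<in> a}" by blast
    let ?H = "(\<lambda>a. a - {x}) ` {a\<in>F. x \<in> a}"
    have "inj_on (\<lambda>a. a - {x}) {a\<in>F. x \<in> a}" by (auto simp: inj_on_def)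
    then have "uncountable ?H" using x countable_image_inj_on by blast
    moreover have "\<forall>a\<in>?H. finite a \<and> card a = n" using Suc.prems(2) by auto
    ultimately obtain G r where G: "G \<subseteq> ?H" "uncountable G" "\<forall>a\<in>G. r \<subseteq> a"
      "pairwise (\<lambda>a b. a \<inter> b = r) G"
      using Suc.IH by meson
    have "inj_on (insert x) G" using G(1) by (auto simp: inj_on_def)
    then have "uncountable (insert x ` G)" using G(2) countable_image_inj_on by blast
    moreover have "insert x ` G \<subseteq> F" using G(1) by (auto simp: insert_absorb)
    moreover have "pairwise (\<lambda>a b. a \<inter> b = insert x r) (insert x ` G)"
      using G(4) by (auto simp: pairwise_def)
    moreover have "\<forall>a\<in>insert x ` G. insert x r \<subseteq> a" using G(3) by blast
    ultimately show ?thesis by blast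
  next
    case False
    have "\<exists>G\<subseteq>F. uncountable G \<and> pairwise (\<lambda>a b. a \<inter> b = {}) G"
    proof (rule uncountable_clique)
      fix M assume M: "M \<subseteq> F" "countable M"
      have "countable (\<Union>M)"
        using M Suc.prems(2) countable_UN[of M id] countable_finite by auto
      then have "countable (\<Union>x\<in>\<Union>M. {a\<in>F. x \<in> a})" using False by blast
      then have "countable (M \<union> (\<Union>x\<in>\<Union>M. {a\<in>F. x \<in> a}))" using M by blast
      then have "\<not> F \<subseteq> M \<union> (\<Union>x\<in>\<Union>M. {a\<in>F. x \<in> a})"
        using Suc.prems(1) countable_subset by blast
      then show "\<exists>x\<in>F - M. \<forall>m\<in>M. m \<inter> x = {}" by blast
    qed blast
    then show ?thesis by blast
  qed
qed

lemma Delta_system: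
  assumes "uncountable F" and "\<forall>a\<in>F. finite a"
  obtains G r n where "G \<subseteq> F" "uncountable G" "\<forall>a\<in>G. r \<subseteq> a \<and> card a = n"
    "pairwise (\<lambda>a b. a \<inter> b = r) G"
proof -
  obtain n where n: "uncountable {a\<in>F. card a = n}"
    using uncountable_fibre[OF assms(1), of card] by blast
  then obtain G r where G: "G \<subseteq> {a\<in>F. card a = n}" "uncountable G" "\<forall>a\<in>G. r \<subseteq> a"
    "pairwise (\<lambda>a b. a \<inter> b = r) G"
    using Delta_system_card[OF n, of n] assms(2) by auto
  show ?thesis by (rule that[of G r n]) (use G in auto)
qed

lemma countable_omega1_bounded:
  assumes "countable (S :: omega1 set)"
  shows "\<exists>\<gamma>. \<forall>\<alpha>\<in>S. \<alpha> < \<gamma>"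
proof (rule ccontr)
  assume "\<not> ?thesis"
  then have "UNIV \<subseteq> (\<Union>\<alpha>\<in>S. insert \<alpha> {..<\<alpha>})" by (force simp: not_less le_less)
  moreover have "countable (\<Union>\<alpha>\<in>S. insert \<alpha> {..<\<alpha>})"
    using assms countable_lessThan_omega1 by blast
  ultimately show False using uncountable_omega1 countable_subset by blast
qed

lemma uncountable_omega1_unbounded:
  assumes "uncountable (S :: omega1 set)"
  shows "\<exists>\<alpha>\<in>S. \<gamma> \<le> \<alpha>"
proof (rule ccontr)
  assume "\<not> ?thesis"
  then have "S \<subseteq> {..<\<gamma>}" by auto
  then show False using assms countable_lessThan_omega1 countable_subset by blast
qed

lemma unbounded_omega1_uncountable:
  assumes "\<And>\<gamma>. \<exists>\<alpha>\<in>S. \<gamma> \<le> (\<alpha>::omega1)"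
  shows "uncountable S"
proof
  assume "countable S"
  then obtain \<gamma> where "\<forall>\<alpha>\<in>S. \<alpha> < \<gamma>" using countable_omega1_bounded by blast
  then show False using assms[of \<gamma>] by force
qed

text \<open>A countable subfamily is bounded by some \<gamma>. By disjointness each of the countably
  many ordinals below \<gamma> lies in at most one member, so some new member lies entirely above
  the subfamily. The relation is symmetrised to suit \<open>uncountable_clique\<close>.\<close>

lemma disjoint_family_set_below:
  fixes F :: "omega1 set set"
  assumes F: "uncountable F" "pairwise disjnt F" "\<forall>a\<in>F. finite a"
  shows "\<exists>G\<subseteq>F. uncountable G \<and> pairwise (\<lambda>a b. set_below a b \<or> set_below b a) G"
proof (rule uncountable_clique)
  fix M assume M: "M \<subseteq> F" "countable M"
  have "countable (\<Union>M)" using M F(3) countable_UN[of M id] countable_finite by auto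
  then obtain \<gamma> where \<gamma>: "\<forall>\<alpha>\<in>\<Union>M. \<alpha> < \<gamma>" using countable_omega1_bounded by blast
  have "countable {a\<in>F. \<alpha> \<in> a}" for \<alpha>
  proof -
    have "{a\<in>F. \<alpha> \<in> a} \<subseteq> {a}" if "a \<in> F" "\<alpha> \<in> a" for a
      using F(2) that unfolding pairwise_def disjnt_def by blast
    then show ?thesis by (metis (no_types, lifting) countable_empty countable_insert
          countable_subset empty_Collect_eq)
  qed
  then have "countable (M \<union> (\<Union>\<alpha>\<in>{..<\<gamma>}. {a\<in>F. \<alpha> \<in> a}))"
    using M countable_lessThan_omega1 by blast
  then have "\<not> F \<subseteq> M \<union> (\<Union>\<alpha>\<in>{..<\<gamma>}. {a\<in>F. \<alpha> \<in> a})"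
    using F(1) countable_subset by blast
  then obtain a where a: "a \<in> F - M" "\<forall>\<alpha>\<in>a. \<not> \<alpha> < \<gamma>" by blast
  have "set_below m a" if "m \<in> M" for m
    unfolding set_below_def using \<gamma> a(2) that by (meson UnionI less_le_trans not_less)
  then show "\<exists>x\<in>F - M. \<forall>m\<in>M. set_below m x \<or> set_below x m" using a by blast
qed blast

section \<open>From the partition relation to U\<close>

text \<open>Greedy colouring by recursion along \<open>R\<close>: each vertex takes the least number
  that its finitely many predecessors leave free.\<close>

lemma finite_down_degree_colouring:
  assumes wf: "wf R" and fin: "\<And>b. finite {a. (a, b) \<in> R}"
  shows "\<exists>\<chi> :: 'a \<Rightarrow> nat. \<forall>(a, b)\<in>R. \<chi> a \<noteq> \<chi> b"
proof -
  define \<chi> :: "'a \<Rightarrow> nat" where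
    "\<chi> = wfrec R (\<lambda>g b. LEAST n. n \<notin> g ` {a. (a, b) \<in> R})"
  have "\<chi> b \<notin> \<chi> ` {a. (a, b) \<in> R}" for b
  proof -
    have "\<chi> b = (LEAST n. n \<notin> cut \<chi> R b ` {a. (a, b) \<in> R})"
      unfolding \<chi>_def by (subst wfrec[OF wf]) simp
    also have "cut \<chi> R b ` {a. (a, b) \<in> R} = \<chi> ` {a. (a, b) \<in> R}"
      by (rule image_cong) (auto simp: cut_apply)
    finally have *: "\<chi> b = (LEAST n. n \<notin> \<chi> ` {a. (a, b) \<in> R})" .
    have "\<exists>n. n \<notin> \<chi> ` {a. (a, b) \<in> R}"
      by (rule ex_new_if_finite) (use fin in auto)
    then show ?thesis unfolding * by (rule LeastI_ex)
  qed
  then show ?thesis by (intro exI[of _ \<chi>]) (force simp: image_iff)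
qed

lemma finite_fibres_witnesses_U:
  assumes fin: "\<And>\<beta> j. \<beta> \<in> X \<Longrightarrow> finite {\<alpha>\<in>X. \<alpha> < \<beta> \<and> p (\<alpha>, \<beta>) = j}"
  shows "witnesses_U p X"
  unfolding witnesses_U_def
proof (intro allI impI, elim conjE)
  fix \<sigma> :: nat and A :: "omega1 set set" and \<delta> :: nat
  assume A: "uncountable A" "pairwise disjnt A" "\<forall>a\<in>A. a \<subseteq> X \<and> finite a \<and> card a = \<sigma>"
  \<comment> \<open>Nonemptiness is what makes \<open>Min\<close> meaningful, both for members of
    \<open>A\<close> and for the image of \<open>p\<close>.\<close>
  have "\<sigma> \<noteq> 0"
  proof
    assume "\<sigma> = 0"
    then have "A \<subseteq> {{}}" using A(3) by auto
    then have "countable A" by (rule countable_subset) simp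
    then show False using A(1) by simp
  qed
  then have ne: "a \<noteq> {}" "finite a" "a \<subseteq> X" if "a \<in> A" for a using A(3) that by auto
  \<comment> \<open>The bad pairs, directed upwards. \<open>Min\<close> strictly increases along
    each edge, so \<open>R\<close> is well-founded.\<close>
  define R where "R = {(a, b). a \<in> A \<and> b \<in> A \<and> set_below a b \<and> (\<exists>\<alpha>\<in>a. \<exists>\<beta>\<in>b. p (\<alpha>, \<beta>) \<le> \<delta>)}"
  have "R \<subseteq> inv_image {(x, y). x < y} Min"
    using ne by (auto simp: R_def set_below_def)
  then have wf: "wf R" using wf wf_subset wf_inv_image by metis
  have "finite {a. (a, b) \<in> R}" for b
  proof (cases "b \<in> A")
    case True
    \<comment> \<open>All possible lower ends of a bad pair whose upper end lies in
      \<open>b\<close>. Every predecessor of \<open>b\<close> contains a point of this finite set,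
      and disjointness of \<open>A\<close> makes distinct predecessors have distinct points
      there.\<close>
    let ?S = "\<Union>\<beta>\<in>b. \<Union>j\<in>{..\<delta>}. {\<alpha>\<in>X. \<alpha> < \<beta> \<and> p (\<alpha>, \<beta>) = j}"
    have "finite ?S" using fin ne[OF True] by blast
    moreover have "\<exists>\<alpha>. \<alpha> \<in> ?S \<and> \<alpha> \<in> a" if "(a, b) \<in> R" for a
      using that ne(3)[of a] unfolding R_def set_below_def by fast
    then have "\<forall>a\<in>{a. (a, b) \<in> R}. \<exists>\<alpha>. \<alpha> \<in> ?S \<and> \<alpha> \<in> a" by simp
    from bchoice[OF this] obtain h where h: "\<And>a. (a, b) \<in> R \<Longrightarrow> h a \<in> ?S \<and> h a \<in> a"
      by blast
    have "inj_on h {a. (a, b) \<in> R}"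
    proof (rule inj_onI)
      fix a a' assume "a \<in> {a. (a, b) \<in> R}" "a' \<in> {a. (a, b) \<in> R}" "h a = h a'"
      then have "a \<in> A" "a' \<in> A" "h a \<in> a" "h a \<in> a'"
        using h[of a] h[of a'] by (auto simp: R_def)
      then show "a = a'" using A(2) unfolding pairwise_def disjnt_def by blast
    qed
    moreover have "h ` {a. (a, b) \<in> R} \<subseteq> ?S" using h by blast
    ultimately show ?thesis using inj_on_finite by blast
  qed (simp add: R_def)
  from finite_down_degree_colouring[OF wf this] obtain \<chi> :: "omega1 set \<Rightarrow> nat"
    where \<chi>: "\<forall>(a, b)\<in>R. \<chi> a \<noteq> \<chi> b" by blast
  \<comment> \<open>A colour class contains no bad pair, so an uncountable one serves as
    \<open>B\<close>.\<close>
  obtain n where n: "uncountable {a\<in>A. \<chi> a = n}"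
    using uncountable_fibre[OF A(1), of \<chi>] by blast
  have "\<delta> < Min (p ` (a \<times> b))" if "(a, b) \<in> set_pairs2 {a\<in>A. \<chi> a = n}" for a b
  proof -
    have ab: "a \<in> A" "b \<in> A" "set_below a b" "(a, b) \<notin> R"
      using that \<chi> by (auto simp: set_pairs2_def)
    then show ?thesis using ne by (subst Min_gr_iff) (auto simp: R_def not_le)
  qed
  then show "\<exists>B\<subseteq>A. uncountable B \<and> (\<forall>(a, b)\<in>set_pairs2 B. Min (p ` (a \<times> b)) > \<delta>)"
    using n by (intro exI[of _ "{a\<in>A. \<chi> a = n}"]) auto
qed

lemma arrow_finite_imp_witnesses_U:
  assumes "arrow_finite p"
  shows "\<exists>X. uncountable X \<and> witnesses_U p X"
proof -
  \<comment> \<open>For fixed \<beta> this enumerates the ordinals below \<beta>, so a finite set of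
    colours \<open>c (\<alpha>, \<beta>)\<close> leaves only finitely many \<alpha>.\<close>
  define c where "c = (\<lambda>(\<alpha>, \<beta>). to_nat_on {..<\<beta>::omega1} \<alpha>)"
  obtain X where X: "uncountable X"
    "\<And>j. finite {c (\<alpha>, \<beta>) | \<alpha> \<beta>. (\<alpha>, \<beta>) \<in> pairs2 X \<and> p (\<alpha>, \<beta>) = j}"
    using assms unfolding arrow_finite_def by blast
  have "finite {\<alpha>\<in>X. \<alpha> < \<beta> \<and> p (\<alpha>, \<beta>) = j}" if "\<beta> \<in> X" for \<beta> j
  proof (rule inj_on_finite)
    show "inj_on (\<lambda>\<alpha>. c (\<alpha>, \<beta>)) {\<alpha>\<in>X. \<alpha> < \<beta> \<and> p (\<alpha>, \<beta>) = j}"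
      using inj_on_to_nat_on[OF countable_lessThan_omega1[of \<beta>]]
      by (auto simp: c_def inj_on_def)
    show "(\<lambda>\<alpha>. c (\<alpha>, \<beta>)) ` {\<alpha>\<in>X. \<alpha> < \<beta> \<and> p (\<alpha>, \<beta>) = j} \<subseteq>
      {c (\<alpha>, \<beta>) | \<alpha> \<beta>. (\<alpha>, \<beta>) \<in> pairs2 X \<and> p (\<alpha>, \<beta>) = j}"
      using that by (auto simp: pairs2_def)
  qed (rule X(2))
  then have "witnesses_U p X" by (rule finite_fibres_witnesses_U)
  then show ?thesis using X(1) by blast
qed

section \<open>Martin's axiom: change of universe and filters with uncountable trace\<close>

text \<open>The successor of \<aleph>0 is the least cardinal above it. The bound lets a poset of
  size at most \<aleph>1 be embedded in any uncountable type.\<close>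

lemma card_omega1_le_uncountable:
  assumes "uncountable (A :: 'a set)"
  shows "|UNIV :: omega1 set| \<le>o |A|"
proof -
  have "bij_betw Rep_omega1 UNIV (Field (cardSuc natLeq))"
    by (metis bij_betw_def inj_onI Rep_omega1_inject
        type_definition.Rep_range[OF type_definition_omega1])
  then have "|UNIV :: omega1 set| =o |Field (cardSuc natLeq)|" using card_of_ordIso by blast
  also have "|Field (cardSuc natLeq)| =o cardSuc natLeq"
    using cardSuc_Card_order[OF natLeq_Card_order] by (rule card_of_Field_ordIso)
  also have "cardSuc natLeq \<le>o |A|"
  proof (rule cardSuc_least[OF natLeq_Card_order card_of_Card_order])
    have "\<not> |A| \<le>o natLeq" using assms by (simp add: countable_card_le_natLeq)
    then show "natLeq <o |A|"
      using not_ordLeq_iff_ordLess natLeq_Well_order card_of_Well_order by blast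
  qed
  finally show ?thesis .
qed

lemma property_KE:
  assumes "property_K P r" "A \<subseteq> P" "uncountable A"
  obtains B where "B \<subseteq> A" "uncountable B" "pairwise (compatible_in P r) B"
proof -
  have "\<exists>B\<subseteq>A. uncountable B \<and> pairwise (compatible_in P r) B"
    using assms by (simp add: property_K_def)
  then show ?thesis by (elim exE conjE) (rule that)
qed

text \<open>A poset of size at most \<open>\<aleph>\<^sub>1\<close> has a copy whose conditions are drawn from \<open>'p\<close>.\<close>

lemma MA_transfer:
  fixes P :: "'q set" and D :: "'i \<Rightarrow> 'q set"
  assumes unc: "uncountable (UNIV :: 'p set)" and MA: "MA_aleph1_K TYPE('p)"
    and cP: "|P| \<le>o |UNIV :: omega1 set|" and cI: "|UNIV :: 'i set| \<le>o |UNIV :: omega1 set|"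
    and P: "P \<noteq> {}" "partial_order_on P r" "property_K P r"
    and D: "\<And>i. dense_in_poset P r (D i)"
  shows "\<exists>G. filter_in_poset P r G \<and> (\<forall>i. G \<inter> D i \<noteq> {})"
proof -
  have "|P| \<le>o |UNIV :: 'p set|"
    using cP card_omega1_le_uncountable[OF unc] ordLeq_transitive by blast
  then obtain \<phi> :: "'q \<Rightarrow> 'p" where \<phi>: "inj_on \<phi> P" by (metis card_of_ordLeq)
  \<comment> \<open>The axiom indexes dense sets by \<open>omega1\<close>; this surjection
    re-indexes the family \<open>D\<close>.\<close>
  obtain g :: "omega1 \<Rightarrow> 'i" where g: "g ` UNIV = UNIV"
    using cI card_of_ordLeq2[of "UNIV :: 'i set" "UNIV :: omega1 set"] by auto
  define r' where "r' = {(\<phi> x, \<phi> y) | x y. x \<in> P \<and> y \<in> P \<and> (x, y) \<in> r}"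
  have r'_iff: "(\<phi> x, \<phi> y) \<in> r' \<longleftrightarrow> (x, y) \<in> r" if "x \<in> P" "y \<in> P" for x y
    using that \<phi> by (auto simp: r'_def inj_on_eq_iff)
  have po: "refl_on P r" "trans r" "antisym r" and rP: "r \<subseteq> P \<times> P"
    using P(2) by (auto simp: partial_order_on_def preorder_on_def)
  have po': "partial_order_on (\<phi> ` P) r'"
    unfolding partial_order_on_def preorder_on_def
  proof (intro conjI)
    show "r' \<subseteq> \<phi> ` P \<times> \<phi> ` P" by (auto simp: r'_def)
    show "refl_on (\<phi> ` P) r'" using po(1) by (auto simp: refl_on_def r'_iff)
    show "trans r'"
    proof (rule transI)
      fix x y z assume "(x, y) \<in> r'" "(y, z) \<in> r'"
      then obtain a b d where "a \<in> P" "b \<in> P" "d \<in> P" "x = \<phi> a" "y = \<phi> b" "z = \<phi> d"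
        by (auto simp: r'_def)
      then show "(x, z) \<in> r'"
        using \<open>(x, y) \<in> r'\<close> \<open>(y, z) \<in> r'\<close> po(2) by (auto simp: r'_iff dest: transD)
    qed
    show "antisym r'"
    proof (rule antisymI)
      fix x y assume "(x, y) \<in> r'" "(y, x) \<in> r'"
      then obtain a b where "a \<in> P" "b \<in> P" "x = \<phi> a" "y = \<phi> b" by (auto simp: r'_def)
      then show "x = y"
        using \<open>(x, y) \<in> r'\<close> \<open>(y, x) \<in> r'\<close> po(3) by (auto simp: r'_iff dest: antisymD)
    qed
  qed
  have compat: "compatible_in (\<phi> ` P) r' (\<phi> x) (\<phi> y)"
    if "compatible_in P r x y" "x \<in> P" "y \<in> P" for x y
    using that by (auto simp: compatible_in_def r'_iff)
  have K': "property_K (\<phi> ` P) r'"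
    unfolding property_K_def
  proof (intro allI impI)
    fix A assume A: "A \<subseteq> \<phi> ` P" "uncountable A"
    then obtain A0 where A0: "A0 \<subseteq> P" "A = \<phi> ` A0" by (meson subset_image_iff)
    then have "uncountable A0" using A(2) by blast
    then obtain B where B: "B \<subseteq> A0" "uncountable B" "pairwise (compatible_in P r) B"
      using property_KE[OF P(3) A0(1)] by blast
    have BP: "B \<subseteq> P" using B A0 by blast
    then have "uncountable (\<phi> ` B)" using B(2) \<phi> countable_image_inj_on inj_on_subset by metis
    moreover have "pairwise (compatible_in (\<phi> ` P) r') (\<phi> ` B)"
      using B(3) BP compat by (fastforce simp: pairwise_def)
    ultimately show "\<exists>B\<subseteq>A. uncountable B \<and> pairwise (compatible_in (\<phi> ` P) r') B"
      using B(1) A0(2) by (intro exI[of _ "\<phi> ` B"]) auto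
  qed
  have DP: "D i \<subseteq> P" for i using D by (simp add: dense_in_poset_def)
  have "dense_in_poset (\<phi> ` P) r' (\<phi> ` D (g \<xi>))" for \<xi>
    unfolding dense_in_poset_def
  proof (intro conjI ballI)
    fix y assume "y \<in> \<phi> ` P"
    then obtain x where x: "x \<in> P" "y = \<phi> x" by blast
    then obtain d where "d \<in> D (g \<xi>)" "(d, x) \<in> r" using D by (meson dense_in_poset_def)
    then show "\<exists>d\<in>\<phi> ` D (g \<xi>). (d, y) \<in> r'" using x DP by (auto simp: r'_iff subset_iff)
  qed (use DP in blast)
  then obtain G where G: "filter_in_poset (\<phi> ` P) r' G" "\<forall>\<xi>. G \<inter> \<phi> ` D (g \<xi>) \<noteq> {}"
    using MA[unfolded MA_aleph1_K_def, rule_format, of "\<phi> ` P" r' "\<lambda>\<xi>. \<phi> ` D (g \<xi>)"]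
      P(1) po' K' by blast
  \<comment> \<open>The pullback of the filter. As \<open>G\<close> lies in the image of
    \<open>P\<close>, it is recovered from \<open>H\<close>, and directedness and upward closure
    carry over.\<close>
  define H where "H = {x\<in>P. \<phi> x \<in> G}"
  have G_im: "G = \<phi> ` H" using G(1) by (auto simp: H_def filter_in_poset_def)
  have "filter_in_poset P r H"
    unfolding filter_in_poset_def
  proof (intro conjI ballI impI)
    show "H \<subseteq> P" by (auto simp: H_def)
    show "H \<noteq> {}" using G(1) G_im by (auto simp: filter_in_poset_def)
    fix x assume x: "x \<in> H"
    { fix y assume "y \<in> P" "(x, y) \<in> r"
      then show "y \<in> H" using G(1) x unfolding filter_in_poset_def H_def
        by (metis (mono_tags, lifting) imageI mem_Collect_eq r'_iff) }
    { fix y assume y: "y \<in> H"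
      then obtain z where z: "z \<in> G" "(z, \<phi> x) \<in> r'" "(z, \<phi> y) \<in> r'"
        using G(1) x unfolding filter_in_poset_def H_def by blast
      then obtain z0 where "z0 \<in> H" "z = \<phi> z0" using G_im by blast
      then show "\<exists>z\<in>H. (z, x) \<in> r \<and> (z, y) \<in> r"
        using x y z(2,3) r'_iff unfolding H_def by blast }
  qed
  moreover have "H \<inter> D i \<noteq> {}" for i
  proof -
    obtain \<xi> where "i = g \<xi>" using g by blast
    then obtain d where "d \<in> D i" "\<phi> d \<in> G" using G(2) by blast
    then show ?thesis using DP by (auto simp: H_def)
  qed
  ultimately show ?thesis by blast
qed

text \<open>The conditions below some \<open>q \<alpha>\<close> with \<xi> \<le> \<alpha> need not
  be dense in \<open>P\<close>, but they are dense below a suitable \<open>s\<close>. The axiom is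
  therefore applied to the cone under \<open>s\<close>, and the filter found there is closed upwards
  in \<open>P\<close>.\<close>

lemma MA_uncountable_filter:
  fixes P :: "'q set" and E :: "nat \<Rightarrow> 'q set" and q :: "omega1 \<Rightarrow> 'q"
  assumes unc: "uncountable (UNIV :: 'p set)" and MA: "MA_aleph1_K TYPE('p)"
    and cP: "|P| \<le>o |UNIV :: omega1 set|"
    and P: "partial_order_on P r" "property_K P r"
    and E: "\<And>n. dense_in_poset P r (E n)"
    and X: "uncountable X" and q: "\<And>\<alpha>. \<alpha> \<in> X \<Longrightarrow> q \<alpha> \<in> P"
  obtains G where "filter_in_poset P r G" "\<And>n. G \<inter> E n \<noteq> {}" "uncountable {\<alpha>\<in>X. q \<alpha> \<in> G}"
proof -
  have po: "\<And>x. x \<in> P \<Longrightarrow> (x, x) \<in> r"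
    "\<And>x y z. (x, y) \<in> r \<Longrightarrow> (y, z) \<in> r \<Longrightarrow> (x, z) \<in> r" and rP: "r \<subseteq> P \<times> P"
    using P(1) by (auto simp: partial_order_on_def preorder_on_def refl_on_def dest: transD)
  \<comment> \<open>\<open>s\<close> forces that uncountably many \<open>q \<alpha>\<close> lie in the generic filter; if no \<open>s\<close> does, witnesses
    of the failure below the \<open>q \<alpha>\<close> contain an uncountable antichain.\<close>
  have "\<exists>s\<in>P. \<forall>s'. (s', s) \<in> r \<longrightarrow> (\<forall>\<xi>. \<exists>\<alpha>\<in>X. \<xi> \<le> \<alpha> \<and> compatible_in P r s' (q \<alpha>))"
  proof (rule ccontr)
    assume "\<not> ?thesis"
    then have "\<forall>s\<in>P. \<exists>s' \<xi>. (s', s) \<in> r \<and> (\<forall>\<alpha>\<in>X. \<xi> \<le> \<alpha> \<longrightarrow> \<not> compatible_in P r s' (q \<alpha>))"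
      by blast
    then have "\<forall>\<alpha>\<in>X. \<exists>u. (fst u, q \<alpha>) \<in> r \<and>
        (\<forall>\<beta>\<in>X. snd u \<le> \<beta> \<longrightarrow> \<not> compatible_in P r (fst u) (q \<beta>))"
      using q by simp
    from bchoice[OF this] obtain u where
      u: "\<forall>\<alpha>\<in>X. (fst (u \<alpha>), q \<alpha>) \<in> r \<and>
        (\<forall>\<beta>\<in>X. snd (u \<alpha>) \<le> \<beta> \<longrightarrow> \<not> compatible_in P r (fst (u \<alpha>)) (q \<beta>))" by blast
    define s where "s = (\<lambda>\<alpha>. fst (u \<alpha>))"
    define \<xi> where "\<xi> = (\<lambda>\<alpha>. snd (u \<alpha>))"
    have s: "\<And>\<alpha>. \<alpha> \<in> X \<Longrightarrow> (s \<alpha>, q \<alpha>) \<in> r"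
      "\<And>\<alpha> \<beta>. \<alpha> \<in> X \<Longrightarrow> \<beta> \<in> X \<Longrightarrow> \<xi> \<alpha> \<le> \<beta> \<Longrightarrow> \<not> compatible_in P r (s \<alpha>) (q \<beta>)"
      using u by (auto simp: s_def \<xi>_def)
    \<comment> \<open>Thin the indices so that, of any two, one lies beyond the threshold
      \<open>\<xi>\<close> of the other.\<close>
    have "\<exists>Y\<subseteq>X. uncountable Y \<and> pairwise (\<lambda>\<alpha> \<beta>. \<xi> \<alpha> \<le> \<beta> \<or> \<xi> \<beta> \<le> \<alpha>) Y"
    proof (rule uncountable_clique)
      fix M assume M: "M \<subseteq> X" "countable M"
      obtain \<gamma> where \<gamma>: "\<forall>\<alpha>\<in>\<xi> ` M. \<alpha> < \<gamma>"
        using countable_omega1_bounded[of "\<xi> ` M"] M by blast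
      have "uncountable (X - M)" using X M by (simp add: uncountable_minus_countable)
      then obtain \<beta> where "\<beta> \<in> X - M" "\<gamma> \<le> \<beta>"
        using uncountable_omega1_unbounded[of "X - M" \<gamma>] by auto
      moreover from this(2) have "\<forall>\<alpha>\<in>M. \<xi> \<alpha> \<le> \<beta>" using \<gamma> by fastforce
      ultimately show "\<exists>\<beta>\<in>X - M. \<forall>\<alpha>\<in>M. \<xi> \<alpha> \<le> \<beta> \<or> \<xi> \<beta> \<le> \<alpha>" by blast
    qed blast
    then obtain Y where Y: "Y \<subseteq> X" "uncountable Y"
      "pairwise (\<lambda>\<alpha> \<beta>. \<xi> \<alpha> \<le> \<beta> \<or> \<xi> \<beta> \<le> \<alpha>) Y" by blast
    \<comment> \<open>A common extension of \<open>s \<alpha>\<close> and \<open>s \<beta>\<close>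
      is also below \<open>q \<alpha>\<close> and \<open>q \<beta>\<close>. This contradicts the
      choice of \<open>s \<alpha>\<close> if \<open>\<xi> \<alpha>\<close> \<le> \<beta>, and that
      of \<open>s \<beta>\<close> if \<open>\<xi> \<beta>\<close> \<le> \<alpha>.\<close>
    have incompat: "\<not> compatible_in P r (s \<alpha>) (s \<beta>)" if "\<alpha> \<in> Y" "\<beta> \<in> Y" "\<alpha> \<noteq> \<beta>" for \<alpha> \<beta>
    proof
      assume "compatible_in P r (s \<alpha>) (s \<beta>)"
      then obtain z where z: "z \<in> P" "(z, s \<alpha>) \<in> r" "(z, s \<beta>) \<in> r"
        by (auto simp: compatible_in_def)
      then have "(z, q \<alpha>) \<in> r" "(z, q \<beta>) \<in> r" using s(1) that Y(1) po(2) by blast+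
      then show False using s(2) z that Y(1,3) unfolding pairwise_def compatible_in_def by blast
    qed
    have sP: "s \<alpha> \<in> P" if "\<alpha> \<in> Y" for \<alpha> using s(1) that Y(1) rP by blast
    \<comment> \<open>A condition is compatible with itself, so equal values would contradict
      \<open>incompat\<close>. Property K then applies to an uncountable antichain.\<close>
    have "inj_on s Y"
    proof (rule inj_onI, rule ccontr)
      fix \<alpha> \<beta> assume *: "\<alpha> \<in> Y" "\<beta> \<in> Y" "s \<alpha> = s \<beta>" "\<alpha> \<noteq> \<beta>"
      have "compatible_in P r (s \<alpha>) (s \<beta>)"
        using *(3) sP[OF *(1)] po(1) by (auto simp: compatible_in_def)
      then show False using incompat * by blast
    qed
    then have "uncountable (s ` Y)" using Y(2) countable_image_inj_on by blast
    then obtain B where B: "B \<subseteq> s ` Y" "uncountable B" "pairwise (compatible_in P r) B"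
      using property_KE[OF P(2), of "s ` Y"] sP by blast
    have "B \<noteq> {}" using B(2) by auto
    then obtain b where b: "b \<in> B" by blast
    have "uncountable (B - {b})" using B(2) by (simp add: uncountable_minus_countable)
    then have "B - {b} \<noteq> {}" using countable_empty by metis
    then obtain b' where b': "b' \<in> B" "b' \<noteq> b" by blast
    then obtain \<alpha> \<beta> where "\<alpha> \<in> Y" "\<beta> \<in> Y" "b = s \<alpha>" "b' = s \<beta>" using b B(1) by blast
    then show False using incompat b b' B(3) unfolding pairwise_def by metis
  qed
  then obtain s where s: "s \<in> P"
    "\<And>s' \<xi>. (s', s) \<in> r \<Longrightarrow> \<exists>\<alpha>\<in>X. \<xi> \<le> \<alpha> \<and> compatible_in P r s' (q \<alpha>)" by blast
  define Q where "Q = {x\<in>P. (x, s) \<in> r}"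
  define rQ where "rQ = r \<inter> Q \<times> Q"
  have down: "x \<in> Q" if "(x, y) \<in> r" "y \<in> Q" for x y
    using that rP po(2) unfolding Q_def by blast
  have poQ: "partial_order_on Q rQ"
    unfolding partial_order_on_def preorder_on_def
  proof (intro conjI)
    show "rQ \<subseteq> Q \<times> Q" by (auto simp: rQ_def)
    show "refl_on Q rQ" using po(1) by (auto simp: refl_on_def rQ_def Q_def)
    show "trans rQ" by (rule transI) (auto simp: rQ_def intro: po(2))
    have "antisym r" using P(1) by (simp add: partial_order_on_def)
    then show "antisym rQ" unfolding rQ_def by (rule antisym_subset[rotated]) blast
  qed
  have KQ: "property_K Q rQ"
    unfolding property_K_def
  proof (intro allI impI)
    fix A assume A: "A \<subseteq> Q" "uncountable A"
    have "A \<subseteq> P" using A by (auto simp: Q_def)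
    then obtain B where B: "B \<subseteq> A" "uncountable B" "pairwise (compatible_in P r) B"
      using property_KE[OF P(2) _ A(2)] by blast
    have "compatible_in Q rQ x y" if "compatible_in P r x y" "x \<in> B" "y \<in> B" for x y
      using that down A(1) B(1) unfolding compatible_in_def rQ_def by blast
    then have "pairwise (compatible_in Q rQ) B" using B(3) by (simp add: pairwise_def)
    then show "\<exists>B\<subseteq>A. uncountable B \<and> pairwise (compatible_in Q rQ) B" using B by blast
  qed
  \<comment> \<open>Index \<open>Inl n\<close> stands for the given dense set \<open>E n\<close>;
    index \<open>Inr \<xi>\<close> makes the filter contain some \<open>q \<alpha>\<close> with
    \<xi> \<le> \<alpha>. Its density in the cone is the property of \<open>s\<close>.\<close>
  define D where "D = case_sum (\<lambda>n. E n \<inter> Q)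
    (\<lambda>\<xi>::omega1. {x\<in>Q. \<exists>\<alpha>\<in>X. \<xi> \<le> \<alpha> \<and> (x, q \<alpha>) \<in> r})"
  have D: "dense_in_poset Q rQ (D i)" for i
  proof (cases i)
    case (Inl n)
    have "\<exists>d\<in>E n. (d, x) \<in> r" if "x \<in> Q" for x
      using E[of n] that unfolding dense_in_poset_def Q_def by blast
    then show ?thesis using Inl down unfolding dense_in_poset_def D_def rQ_def by auto blast
  next
    case (Inr \<xi>)
    have "\<exists>d\<in>Q. (d, x) \<in> r \<and> (\<exists>\<alpha>\<in>X. \<xi> \<le> \<alpha> \<and> (d, q \<alpha>) \<in> r)" if "x \<in> Q" for x
      using s(2)[of x \<xi>] that down unfolding compatible_in_def Q_def by blast
    then show ?thesis using Inr unfolding dense_in_poset_def D_def rQ_def by auto blast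
  qed
  have inf: "infinite (UNIV :: omega1 set)" using uncountable_omega1 countable_finite by blast
  have "|UNIV :: nat set| \<le>o |UNIV :: omega1 set|"
    using inf infinite_iff_card_of_nat by blast
  then have cI: "|UNIV :: (nat + omega1) set| \<le>o |UNIV :: omega1 set|"
    unfolding UNIV_Plus_UNIV[symmetric]
    by (rule card_of_Plus_ordLeq_infinite_Field[OF _ _ card_of_mono1[OF subset_UNIV]
          card_of_Card_order, rotated]) (simp only: Field_card_of inf not_False_eq_True)
  have "Q \<subseteq> P" by (auto simp: Q_def)
  then have cQ: "|Q| \<le>o |UNIV :: omega1 set|" using cP card_of_mono1 ordLeq_transitive by blast
  have "s \<in> Q" using s po(1) by (auto simp: Q_def)
  then have "Q \<noteq> {}" by blast
  from MA_transfer[where D = D, OF unc MA cQ cI this poQ KQ D]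
  obtain G where G: "filter_in_poset Q rQ G" "\<And>i. G \<inter> D i \<noteq> {}" by metis
  define H where "H = {y\<in>P. \<exists>x\<in>G. (x, y) \<in> r}"
  have GQ: "G \<subseteq> Q" "G \<noteq> {}" using G(1) by (auto simp: filter_in_poset_def)
  have GH: "G \<subseteq> H" using GQ po(1) by (auto simp: H_def Q_def)
  have "filter_in_poset P r H"
    unfolding filter_in_poset_def
  proof (intro conjI ballI impI)
    show "H \<subseteq> P" by (auto simp: H_def)
    show "H \<noteq> {}" using GH GQ by blast
    fix x assume x: "x \<in> H"
    { fix y assume "y \<in> P" "(x, y) \<in> r"
      then show "y \<in> H" using x po(2) unfolding H_def by blast }
    { fix y assume "y \<in> H"
      then obtain x0 y0 where xy: "x0 \<in> G" "y0 \<in> G" "(x0, x) \<in> r" "(y0, y) \<in> r"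
        using x by (auto simp: H_def)
      then obtain z where "z \<in> G" "(z, x0) \<in> r" "(z, y0) \<in> r"
        using G(1) unfolding filter_in_poset_def rQ_def by blast
      then show "\<exists>z\<in>H. (z, x) \<in> r \<and> (z, y) \<in> r" using xy GH po(2) by blast }
  qed
  moreover have "H \<inter> E n \<noteq> {}" for n using G(2)[of "Inl n"] GH by (auto simp: D_def)
  moreover have "uncountable {\<alpha>\<in>X. q \<alpha> \<in> H}"
  proof (rule unbounded_omega1_uncountable)
    fix \<xi>
    obtain x \<alpha> where "x \<in> G" "\<alpha> \<in> X" "\<xi> \<le> \<alpha>" "(x, q \<alpha>) \<in> r"
      using G(2)[of "Inr \<xi>"] by (auto simp: D_def)
    then show "\<exists>\<alpha>\<in>{\<alpha>\<in>X. q \<alpha> \<in> H}. \<xi> \<le> \<alpha>" using q by (auto simp: H_def)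
  qed
  ultimately show ?thesis by (rule that)
qed

section \<open>The bounding poset, and from U to the partition relation\<close>

text \<open>\<open>f\<close> is a finite piece of a function bounding \<open>c\<close> on the fibres
  of \<open>p\<close>; fibres beyond its length are still free. Since \<open>f\<close> is a list of
  naturals, only countably many promises occur.\<close>

definition bounded_by :: "(omega1 \<times> omega1 \<Rightarrow> nat) \<Rightarrow> (omega1 \<times> omega1 \<Rightarrow> nat) \<Rightarrow>
    nat list \<Rightarrow> omega1 set \<Rightarrow> bool"
  where "bounded_by p c f a \<longleftrightarrow>
    (\<forall>(\<alpha>, \<beta>)\<in>pairs2 a. p (\<alpha>, \<beta>) < length f \<longrightarrow> c (\<alpha>, \<beta>) \<le> f ! p (\<alpha>, \<beta>))"

definition bounding_poset :: "(omega1 \<times> omega1 \<Rightarrow> nat) \<Rightarrow> (omega1 \<times> omega1 \<Rightarrow> nat) \<Rightarrow>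
    omega1 set \<Rightarrow> (omega1 set \<times> nat list) set"
  where "bounding_poset p c X = {(a, f). finite a \<and> a \<subseteq> X \<and> bounded_by p c f a}"

definition bounding_order :: "(omega1 \<times> omega1 \<Rightarrow> nat) \<Rightarrow> (omega1 \<times> omega1 \<Rightarrow> nat) \<Rightarrow>
    omega1 set \<Rightarrow> (omega1 set \<times> nat list) rel"
  where "bounding_order p c X = {((a', f'), (a, f)). (a', f') \<in> bounding_poset p c X \<and>
    (a, f) \<in> bounding_poset p c X \<and> a \<subseteq> a' \<and> (\<exists>g. f' = f @ g)}"

lemma bounded_byD:
  "bounded_by p c f a \<Longrightarrow> \<alpha> \<in> a \<Longrightarrow> \<beta> \<in> a \<Longrightarrow> \<alpha> < \<beta> \<Longrightarrow> p (\<alpha>, \<beta>) < length f \<Longrightarrow>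
    c (\<alpha>, \<beta>) \<le> f ! p (\<alpha>, \<beta>)"
  by (auto simp: bounded_by_def pairs2_def)

lemma bounded_byI:
  "(\<And>\<alpha> \<beta>. \<alpha> \<in> a \<Longrightarrow> \<beta> \<in> a \<Longrightarrow> \<alpha> < \<beta> \<Longrightarrow> p (\<alpha>, \<beta>) < length f \<Longrightarrow> c (\<alpha>, \<beta>) \<le> f ! p (\<alpha>, \<beta>)) \<Longrightarrow>
    bounded_by p c f a"
  by (auto simp: bounded_by_def pairs2_def)

lemma partial_order_bounding: "partial_order_on (bounding_poset p c X) (bounding_order p c X)"
  unfolding partial_order_on_def preorder_on_def
proof (intro conjI)
  show "bounding_order p c X \<subseteq> bounding_poset p c X \<times> bounding_poset p c X"
    by (auto simp: bounding_order_def)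
  show "refl_on (bounding_poset p c X) (bounding_order p c X)"
    by (auto simp: refl_on_def bounding_order_def)
  show "trans (bounding_order p c X)"
    by (rule transI) (auto simp: bounding_order_def)
  show "antisym (bounding_order p c X)"
    by (rule antisymI) (auto simp: bounding_order_def)
qed

text \<open>By induction on \<open>n\<close>, insertion of a point maps pairs of a point and an
  \<open>n\<close>-element set onto a superset of the sets of size \<open>Suc n\<close>; an infinite
  cardinal absorbs such products and countable unions. This bounds the size of the bounding poset,
  as \<open>MA_transfer\<close> requires.\<close>

lemma card_of_finite_subsets_infinite:
  assumes inf: "infinite (UNIV :: 'a set)"
  shows "|{a :: 'a set. finite a}| \<le>o |UNIV :: 'a set|"
proof -
  let ?F = "\<lambda>n. {a :: 'a set. finite a \<and> card a = n}"
  have "|?F n| \<le>o |UNIV :: 'a set|" for n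
  proof (induction n)
    case 0
    have "?F 0 = {{}}" by auto
    then show ?case by (simp add: card_of_singl_ordLeq)
  next
    case (Suc n)
    have "?F (Suc n) \<subseteq> (\<lambda>(x, a). insert x a) ` (UNIV \<times> ?F n)"
      by (force simp: card_Suc_eq image_iff)
    then have "|?F (Suc n)| \<le>o |(UNIV :: 'a set) \<times> ?F n|" by (rule surj_imp_ordLeq)
    moreover have "|(UNIV :: 'a set) \<times> ?F n| \<le>o |UNIV :: 'a set|"
      by (intro card_of_Sigma_ordLeq_infinite[OF inf] card_of_mono1 subset_UNIV ballI Suc.IH)
    ultimately show ?case by (rule ordLeq_transitive)
  qed
  then have "|\<Union>n. ?F n| \<le>o |UNIV :: 'a set|"
    by (intro card_of_UNION_ordLeq_infinite[OF inf] ballI)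
      (simp add: inf infinite_iff_card_of_nat[symmetric])
  moreover have "(\<Union>n. ?F n) = {a. finite a}" by auto
  ultimately show ?thesis by simp
qed

lemma card_bounding_poset: "|bounding_poset p c X| \<le>o |UNIV :: omega1 set|"
proof -
  have inf: "infinite (UNIV :: omega1 set)" using uncountable_omega1 countable_finite by blast
  have "|UNIV :: nat list set| \<le>o |UNIV :: omega1 set|"
  proof -
    have "|UNIV :: nat list set| \<le>o natLeq"
      by (simp add: countable_card_le_natLeq[symmetric])
    also have "natLeq \<le>o |UNIV :: omega1 set|" using inf infinite_iff_natLeq_ordLeq by blast
    finally show ?thesis .
  qed
  then have "|{a :: omega1 set. finite a} \<times> (UNIV :: nat list set)| \<le>o |UNIV :: omega1 set|"
    by (intro card_of_Sigma_ordLeq_infinite[OF inf] card_of_finite_subsets_infinite[OF inf] ballI)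
  moreover have "bounding_poset p c X \<subseteq> {a. finite a} \<times> UNIV"
    by (auto simp: bounding_poset_def)
  ultimately show ?thesis using card_of_mono1 ordLeq_transitive by blast
qed

lemma property_K_bounding:
  assumes U: "witnesses_U p X"
  shows "property_K (bounding_poset p c X) (bounding_order p c X)"
  unfolding property_K_def
proof (intro allI impI)
  fix A assume A: "A \<subseteq> bounding_poset p c X" "uncountable A"
  obtain f where "uncountable {x\<in>A. snd x = f}"
    using uncountable_fibre[OF A(2), of snd] by blast
  moreover have "inj_on fst {x\<in>A. snd x = f}" by (auto simp: inj_on_def)
  ultimately have uF: "uncountable (fst ` {x\<in>A. snd x = f})"
    using countable_image_inj_on by blast
  have F: "(a, f) \<in> A" "finite a" "a \<subseteq> X" "bounded_by p c f a"
    if "a \<in> fst ` {x\<in>A. snd x = f}" for a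
    using that A(1) by (auto simp: bounding_poset_def)
  obtain G \<rho> n where G: "G \<subseteq> fst ` {x\<in>A. snd x = f}" "uncountable G"
    "\<forall>a\<in>G. \<rho> \<subseteq> a \<and> card a = n" "pairwise (\<lambda>a b. a \<inter> b = \<rho>) G"
    using Delta_system[OF uF] F(2) by blast
  \<comment> \<open>The tails are pairwise disjoint and, as the Delta-system has members of one
    size, all of size \<open>n - card \<rho>\<close>, as U demands.\<close>
  let ?T = "(\<lambda>a. a - \<rho>) ` G"
  have "inj_on (\<lambda>a. a - \<rho>) G" using G(3) by (auto simp: inj_on_def)
  then have uT: "uncountable ?T" using G(2) countable_image_inj_on by blast
  have dT: "pairwise disjnt ?T" using G(4) unfolding pairwise_def disjnt_def by blast
  have "\<forall>t\<in>?T. t \<subseteq> X \<and> finite t \<and> card t = n - card \<rho>"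
  proof
    fix t assume "t \<in> ?T"
    then obtain a where a: "a \<in> G" "t = a - \<rho>" by blast
    then have "a \<in> fst ` {x\<in>A. snd x = f}" "\<rho> \<subseteq> a" "card a = n" using G(1,3) by auto
    moreover note F(2,3)[OF this(1)]
    ultimately show "t \<subseteq> X \<and> finite t \<and> card t = n - card \<rho>"
      using a(2) by (auto simp: card_Diff_subset finite_subset)
  qed
  then obtain T1 where T1: "T1 \<subseteq> ?T" "uncountable T1"
    "\<forall>(s, t)\<in>set_pairs2 T1. length f < Min (p ` (s \<times> t))"
    using U[unfolded witnesses_U_def, rule_format, of ?T "n - card \<rho>" "length f"] uT dT by blast
  have finT: "finite t" if "t \<in> ?T" for t using that F(2) G(1) by blast
  \<comment> \<open>U speaks only of tails one of which lies below the other; this thinning brings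
    any two tails into that position.\<close>
  obtain T2 where T2: "T2 \<subseteq> T1" "uncountable T2"
    "pairwise (\<lambda>s t. set_below s t \<or> set_below t s) T2"
    using disjoint_family_set_below[OF T1(2)] dT T1(1) finT by (meson pairwise_subset subsetD)
  have far: "length f < p (\<alpha>, \<beta>)" if st: "s \<in> T2" "t \<in> T2" "s \<noteq> t" "\<alpha> \<in> s" "\<beta> \<in> t" "\<alpha> < \<beta>"
    for s t \<alpha> \<beta>
  proof -
    have "set_below s t"
      using T2(3) st unfolding pairwise_def set_below_def by (meson less_asym)
    then have "(s, t) \<in> set_pairs2 T1" using st T2(1) by (auto simp: set_pairs2_def)
    then have "length f < Min (p ` (s \<times> t))" using T1(3) by blast
    also have "\<dots> \<le> p (\<alpha>, \<beta>)"
      using finT[of s] finT[of t] st T1(1) T2(1)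
      by (intro Min_le finite_imageI finite_cartesian_product) auto
    finally show ?thesis .
  qed
  \<comment> \<open>Restoring the root turns the tails back into conditions from
    \<open>A\<close>.\<close>
  define B where "B = (\<lambda>t. (t \<union> \<rho>, f)) ` T2"
  have T2G: "t \<union> \<rho> \<in> G \<and> t \<inter> \<rho> = {}" if t: "t \<in> T2" for t
  proof -
    obtain a where "a \<in> G" "t = a - \<rho>" using t T1(1) T2(1) by blast
    moreover have "a - \<rho> \<union> \<rho> = a" using G(3) calculation(1) by blast
    ultimately show ?thesis by auto
  qed
  have "inj_on (\<lambda>t. (t \<union> \<rho>, f)) T2" using T2G by (auto simp: inj_on_def)
  then have "uncountable B" unfolding B_def using T2(2) countable_image_inj_on by blast
  moreover have "B \<subseteq> A" unfolding B_def using T2G G(1) F(1) by blast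
  moreover have "compatible_in (bounding_poset p c X) (bounding_order p c X) x y"
    if xy: "x \<in> B" "y \<in> B" "x \<noteq> y" for x y
  proof -
    obtain s t where st: "s \<in> T2" "t \<in> T2" "s \<noteq> t" "x = (s \<union> \<rho>, f)" "y = (t \<union> \<rho>, f)"
      using xy by (auto simp: B_def)
    have "s \<union> \<rho> \<in> fst ` {x\<in>A. snd x = f}" "t \<union> \<rho> \<in> fst ` {x\<in>A. snd x = f}"
      using T2G[OF st(1)] T2G[OF st(2)] G(1) by blast+
    note s = F(2-4)[OF this(1)] and t = F(2-4)[OF this(2)]
    have "bounded_by p c f (s \<union> t \<union> \<rho>)"
    proof (rule bounded_byI)
      fix \<alpha> \<beta> assume ab: "\<alpha> \<in> s \<union> t \<union> \<rho>" "\<beta> \<in> s \<union> t \<union> \<rho>" "\<alpha> < \<beta>" "p (\<alpha>, \<beta>) < length f"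
      \<comment> \<open>A pair that meets the root lies inside one of the two conditions. The last
        two cases are the mixed pairs, where \<open>far\<close> refutes
        \<open>p (\<alpha>, \<beta>) < length f\<close>.\<close>
      then consider "\<alpha> \<in> s \<union> \<rho>" "\<beta> \<in> s \<union> \<rho>" | "\<alpha> \<in> t \<union> \<rho>" "\<beta> \<in> t \<union> \<rho>"
        | "\<alpha> \<in> s" "\<beta> \<in> t" | "\<alpha> \<in> t" "\<beta> \<in> s" by blast
      then show "c (\<alpha>, \<beta>) \<le> f ! p (\<alpha>, \<beta>)"
      proof cases
        case 1 then show ?thesis using bounded_byD[OF s(3)] ab by blast
      next
        case 2 then show ?thesis using bounded_byD[OF t(3)] ab by blast
      next
        case 3 then show ?thesis using far[OF st(1,2,3)] ab by fastforce
      next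
        case 4 then show ?thesis using far[OF st(2,1) st(3)[symmetric]] ab by fastforce
      qed
    qed
    then have "(s \<union> t \<union> \<rho>, f) \<in> bounding_poset p c X"
      using s t by (auto simp: bounding_poset_def)
    then show ?thesis using s t unfolding compatible_in_def
      by (intro bexI[of _ "(s \<union> t \<union> \<rho>, f)"]) (auto simp: bounding_order_def bounding_poset_def st)
  qed
  then have "pairwise (compatible_in (bounding_poset p c X) (bounding_order p c X)) B"
    by (simp add: pairwise_def)
  ultimately show "\<exists>B\<subseteq>A. uncountable B \<and>
      pairwise (compatible_in (bounding_poset p c X) (bounding_order p c X)) B" by blast
qed

lemma dense_bounding_length:
  "dense_in_poset (bounding_poset p c X) (bounding_order p c X)
    {(a, f) \<in> bounding_poset p c X. n < length f}"
  unfolding dense_in_poset_def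
proof (intro conjI ballI)
  fix x assume x: "x \<in> bounding_poset p c X"
  obtain a f where af: "x = (a, f)" "finite a" "a \<subseteq> X" "bounded_by p c f a"
    using x by (auto simp: bounding_poset_def)
  \<comment> \<open>A bound for all colours on the finite set \<open>a\<close>, so padding
    \<open>f\<close> with it makes only promises that already hold; the inserted 0 covers empty
    \<open>a\<close>.\<close>
  define m where "m = Max (insert 0 (c ` (a \<times> a)))"
  have m: "c (\<alpha>, \<beta>) \<le> m" if "\<alpha> \<in> a" "\<beta> \<in> a" for \<alpha> \<beta>
    unfolding m_def using that af(2) by (intro Max_ge) auto
  define f' where "f' = f @ replicate (Suc n) m"
  have "bounded_by p c f' a"
  proof (rule bounded_byI)
    fix \<alpha> \<beta> assume "\<alpha> \<in> a" "\<beta> \<in> a" "\<alpha> < \<beta>" "p (\<alpha>, \<beta>) < length f'"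
    then show "c (\<alpha>, \<beta>) \<le> f' ! p (\<alpha>, \<beta>)"
      using bounded_byD[OF af(4)] m by (auto simp: f'_def nth_append simp del: replicate_Suc)
  qed
  then have "(a, f') \<in> bounding_poset p c X" using af by (auto simp: bounding_poset_def)
  then show "\<exists>d\<in>{(a, f) \<in> bounding_poset p c X. n < length f}. (d, x) \<in> bounding_order p c X"
    using x af(1) by (intro bexI[of _ "(a, f')"]) (auto simp: bounding_order_def f'_def)
qed auto

lemma witnesses_U_imp_arrow_finite:
  assumes unc: "uncountable (UNIV :: 'p set)" and MA: "MA_aleph1_K TYPE('p)"
    and X: "uncountable X" and U: "witnesses_U p X"
  shows "arrow_finite p"
  unfolding arrow_finite_def
proof
  fix c :: "omega1 \<times> omega1 \<Rightarrow> nat"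
  let ?P = "bounding_poset p c X" and ?r = "bounding_order p c X"
  have single: "({\<alpha>}, []) \<in> ?P" if "\<alpha> \<in> X" for \<alpha>
    using that by (auto simp: bounding_poset_def bounded_by_def)
  obtain G where G: "filter_in_poset ?P ?r G" "\<And>n. G \<inter> {(a, f) \<in> ?P. n < length f} \<noteq> {}"
    "uncountable {\<alpha>\<in>X. ({\<alpha>}, []) \<in> G}"
    by (rule MA_uncountable_filter[where E = "\<lambda>n. {(a, f) \<in> ?P. n < length f}",
          OF unc MA card_bounding_poset partial_order_bounding property_K_bounding[OF U]
          dense_bounding_length X, of "\<lambda>\<alpha>. ({\<alpha>}, [])"]) (rule single, assumption, rule that)
  \<comment> \<open>The generic set. Its points enter through singleton conditions with no promise,
    so directedness puts any two of them, with any promise from \<open>G\<close>, into one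
    condition.\<close>
  let ?Y = "{\<alpha>\<in>X. ({\<alpha>}, []) \<in> G}"
  have dir: "\<exists>z\<in>G. (z, x) \<in> ?r \<and> (z, y) \<in> ?r" if "x \<in> G" "y \<in> G" for x y
    using G(1) that unfolding filter_in_poset_def by blast
  have "finite {c (\<alpha>, \<beta>) | \<alpha> \<beta>. (\<alpha>, \<beta>) \<in> pairs2 ?Y \<and> p (\<alpha>, \<beta>) = j}" for j
  proof -
    obtain a f where af: "(a, f) \<in> G" "j < length f" using G(2)[of j] by blast
    have "c (\<alpha>, \<beta>) \<le> f ! j" if ab: "\<alpha> \<in> ?Y" "\<beta> \<in> ?Y" "\<alpha> < \<beta>" "p (\<alpha>, \<beta>) = j" for \<alpha> \<beta>
    proof -
      obtain z where z: "z \<in> G" "(z, ({\<alpha>}, [])) \<in> ?r" "(z, ({\<beta>}, [])) \<in> ?r"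
        using dir ab by blast
      \<comment> \<open>\<open>w\<close> contains both points, and its list extends
        \<open>f\<close>. Hence entry \<open>j\<close> of \<open>f\<close>, chosen before the
        points, bounds their colour.\<close>
      obtain w where w: "w \<in> G" "(w, z) \<in> ?r" "(w, (a, f)) \<in> ?r" using dir z(1) af(1) by blast
      obtain b g where bg: "w = (b, f @ g)" "bounded_by p c (f @ g) b"
        using w(3) by (auto simp: bounding_order_def bounding_poset_def)
      have "\<alpha> \<in> b" "\<beta> \<in> b" using z w(2) bg(1) by (auto simp: bounding_order_def)
      then show ?thesis using bounded_byD[OF bg(2), of \<alpha> \<beta>] ab af(2) by (simp add: nth_append)
    qed
    then have "{c (\<alpha>, \<beta>) | \<alpha> \<beta>. (\<alpha>, \<beta>) \<in> pairs2 ?Y \<and> p (\<alpha>, \<beta>) = j} \<subseteq> {..f ! j}"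
      by (auto simp: pairs2_def)
    then show ?thesis using finite_subset by blast
  qed
  then show "\<exists>X. uncountable X \<and>
      (\<forall>j. finite {c (\<alpha>, \<beta>) | \<alpha> \<beta>. (\<alpha>, \<beta>) \<in> pairs2 X \<and> p (\<alpha>, \<beta>) = j})"
    using G(3) by blast
qed

theorem theoremB:
  fixes p :: "omega1 \<times> omega1 \<Rightarrow> nat"
  assumes "uncountable (UNIV :: 'p set)"
    and "MA_aleph1_K TYPE('p)"
  shows "arrow_finite p \<longleftrightarrow> (\<exists>X. uncountable X \<and> witnesses_U p X)"
  using arrow_finite_imp_witnesses_U witnesses_U_imp_arrow_finite[OF assms] by blast

end
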